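(* Let $(\mathcal{A},\cdot)$ be an associative subalgebra of an algebra $\mathcal{H}$. Suppose that $\mathcal{H}$ has the following property: there exists $u\in\mathcal{H}$ such that $u\cdot x\in\mathcal{A}$ and $x\cdot u=u\cdot x$ for all $x\in\mathcal{A}$. Then the linear map $R:\mathcal{A}\to\mathcal{A}$ defined by $R(x)=u\cdot x$ satisfies the left averaging identity $$R(a)\cdot R(b)=R(R(a)\cdot b)\quad\text{for all }a,b\in\mathcal{A}.$$ Furthermore, if $u^{2}=u$, then $$R(a)\cdot R(b)=R(R(a)\cdot b)=R(a\cdot b)\quad\text{for all }a,b\in\mathcal{A}.$$
   Context: An algebra is a vector space over a field with a bilinear product; $\cdot$ denotes the product of $\mathcal{H}$ and its restriction to $\mathcal{A}$, and $u^{2}=u\cdot u$.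
   Formalization: The claim fails for a general nonassociative algebra H (u may act on A by any linear map, e.g. swapping two orthogonal idempotents), so it is additionally assumed that the product is associative on all triples from A together with u; this is automatic when H is associative. *)

theory Defs
  imports Complex_Main
begin

text \<open>
  An algebra is a vector space over a field with a bilinear product; neither associativity
  nor a unit is assumed.
\<close>

locale nonassoc_algebra = vector_space scale
  for scale :: "'k::field \<Rightarrow> 'h::ab_group_add \<Rightarrow> 'h" +
  fixes mult :: "'h \<Rightarrow> 'h \<Rightarrow> 'h"
  assumes linear_mult_left: "Vector_Spaces.linear scale scale (\<lambda>x. mult x y)"
    and linear_mult_right: "Vector_Spaces.linear scale scale (\<lambda>y. mult x y)"
begin

definition subalgebra :: "'h set \<Rightarrow> bool" where
  "subalgebra A \<longleftrightarrow> subspace A \<and> (\<forall>x\<in>A. \<forall>y\<in>A. mult x y \<in> A)"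

end

text \<open>
  Associativity of a subalgebra \<open>A\<close> is \<open>associative_on A\<close>. It says nothing about products that
  involve an element \<open>u\<close> outside \<open>A\<close>. In a general algebra, multiplication by such a \<open>u\<close> can
  induce an arbitrary linear endomorphism of \<open>A\<close>, so results about it need associativity on
  \<open>insert u A\<close>, which is automatic if the ambient algebra is associative.
\<close>

definition associative_on :: "'h set \<Rightarrow> ('h \<Rightarrow> 'h \<Rightarrow> 'h) \<Rightarrow> bool" where
  "associative_on S mult \<longleftrightarrow>
    (\<forall>x\<in>S. \<forall>y\<in>S. \<forall>z\<in>S. mult (mult x y) z = mult x (mult y z))"

text \<open>
  The values of \<open>R\<close> outside \<open>A\<close> are irrelevant. When \<open>A\<close> is a subspace, this says that
  \<open>R\<close> restricts to a linear map from \<open>A\<close> to \<open>A\<close>.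
\<close>

definition linear_endo_on ::
  "('k \<Rightarrow> 'h \<Rightarrow> 'h) \<Rightarrow> 'h::ab_group_add set \<Rightarrow> ('h \<Rightarrow> 'h) \<Rightarrow> bool" where
  "linear_endo_on scale A R \<longleftrightarrow>
    (\<forall>x\<in>A. R x \<in> A) \<and>
    (\<forall>x\<in>A. \<forall>y\<in>A. R (x + y) = R x + R y) \<and>
    (\<forall>c. \<forall>x\<in>A. R (scale c x) = scale c (R x))"

definition left_averaging_on ::
  "('h \<Rightarrow> 'h \<Rightarrow> 'h) \<Rightarrow> 'h set \<Rightarrow> ('h \<Rightarrow> 'h) \<Rightarrow> bool" where
  "left_averaging_on mult A R \<longleftrightarrow>
    (\<forall>a\<in>A. \<forall>b\<in>A. mult (R a) (R b) = R (mult (R a) b))"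

end

theory Submission
  imports Defs
begin

text \<open>
  Since \<open>u\<close> commutes with the element \<open>u \<cdot> a\<close> of \<open>A\<close>, the inner factor \<open>u\<close> in
  \<open>(u \<cdot> a) \<cdot> (u \<cdot> b)\<close> can be moved to the front. This gives \<open>u \<cdot> ((u \<cdot> a) \<cdot> b)\<close>, which is
  the averaging identity. By associativity that element also equals \<open>(u \<cdot> u) \<cdot> (a \<cdot> b)\<close>, and
  an idempotent \<open>u\<close> turns it into \<open>u \<cdot> (a \<cdot> b)\<close>. Linearity of \<open>R\<close> is linearity of the
  product in its second argument.
\<close>

theorem proposition6p1p1:
  fixes scale :: "'k::field \<Rightarrow> 'h::ab_group_add \<Rightarrow> 'h"
    and mult :: "'h \<Rightarrow> 'h \<Rightarrow> 'h"  (infixl "\<cdot>" 70)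
    and A :: "'h set" and u :: 'h and R :: "'h \<Rightarrow> 'h"
  assumes algebra: "nonassoc_algebra scale mult"
    and subalgebra: "nonassoc_algebra.subalgebra scale mult A"
    and assoc_A: "associative_on A mult"
    and assoc_u: "associative_on (insert u A) mult"
    and u_mult: "\<And>x. x \<in> A \<Longrightarrow> u \<cdot> x \<in> A"
    and u_commute: "\<And>x. x \<in> A \<Longrightarrow> x \<cdot> u = u \<cdot> x"
    and R: "\<And>x. x \<in> A \<Longrightarrow> R x = u \<cdot> x"
  shows "linear_endo_on scale A R \<and>
    left_averaging_on mult A R \<and>
    (u \<cdot> u = u \<longrightarrow>
      (\<forall>a\<in>A. \<forall>b\<in>A. R a \<cdot> R b = R (R a \<cdot> b) \<and> R (R a \<cdot> b) = R (a \<cdot> b)))"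
proof -
  interpret nonassoc_algebra scale mult by (fact algebra)
  have A_mult: "x \<cdot> y \<in> A" if "x \<in> A" "y \<in> A" for x y
    using subalgebra that by (auto simp: subalgebra_def)
  have A_add: "x + y \<in> A" if "x \<in> A" "y \<in> A" for x y
    using subalgebra that by (auto simp: subalgebra_def subspace_add)
  have A_scale: "scale c x \<in> A" if "x \<in> A" for c x
    using subalgebra that by (auto simp: subalgebra_def subspace_scale)
  have assoc: "(x \<cdot> y) \<cdot> z = x \<cdot> (y \<cdot> z)"
    if "x \<in> insert u A" "y \<in> insert u A" "z \<in> insert u A" for x y z
    using assoc_u that unfolding associative_on_def by blast
  interpret u: Vector_Spaces.linear scale scale "\<lambda>x. u \<cdot> x"
    by (rule linear_mult_right)
  have endo: "linear_endo_on scale A R"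
    by (simp add: linear_endo_on_def R u_mult A_add A_scale u.add u.scale)
  have averaging: "R a \<cdot> R b = R (R a \<cdot> b)" if a: "a \<in> A" and b: "b \<in> A" for a b
  proof -
    have "(u \<cdot> a) \<cdot> (u \<cdot> b) = ((u \<cdot> a) \<cdot> u) \<cdot> b"
      using assoc[of "u \<cdot> a" u b] a b u_mult by simp
    also have "\<dots> = (u \<cdot> (u \<cdot> a)) \<cdot> b"
      using u_commute u_mult a by simp
    also have "\<dots> = u \<cdot> ((u \<cdot> a) \<cdot> b)"
      using assoc[of u "u \<cdot> a" b] a b u_mult by simp
    finally show ?thesis
      using a b by (simp add: R u_mult A_mult)
  qed
  have idempotent: "R (R a \<cdot> b) = R (a \<cdot> b)"
    if u: "u \<cdot> u = u" and a: "a \<in> A" and b: "b \<in> A" for a b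
  proof -
    have "u \<cdot> ((u \<cdot> a) \<cdot> b) = u \<cdot> (u \<cdot> (a \<cdot> b))"
      using assoc[of u a b] a b by simp
    also have "\<dots> = u \<cdot> (a \<cdot> b)"
      using assoc[of u u "a \<cdot> b"] u a b A_mult by simp
    finally show ?thesis
      using a b by (simp add: R u_mult A_mult)
  qed
  show ?thesis
    using endo averaging idempotent by (auto simp: left_averaging_on_def)
qed

end
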